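(* There exists an absolute constant $C$ such that the following holds. Let $f\colon\{0,1\}^n\to\{0,1\}$ be a monotone Boolean function with critical probability $p_c$, let $p\le p_c$ and $M>0$. Suppose that $f$ is $M$-global in the interval $[p,p_c]$ and that $\mu_p(f)\ge e^{-M/C}$. Then $p_c\le M^C p$.
   Context: $\mu_q$ is the $q$-biased product measure on $\{0,1\}^n$, $\mu_q(f)=\mathbb{E}_{\mu_q}[f]$. $f$ is monotone if $f(x)\le f(y)$ whenever $x_i\le y_i$ for all $i$. The critical probability is $p_c=\inf\{q:\mu_q(f)\ge 1/2\}$. For $J\subseteq[n]$, $f_{J\to1}$ is the restriction of $f$ setting coordinates in $J$ to $1$. A monotone Boolean $f$ is $M$-global in an interval $I$ if for every set $J\subseteq[n]$ with $|J|\le M$ and every $q\in I$ we have $\mu_q(f_{J\to1})\le\mu_q(f)^{0.01}$. *)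

theory Defs
  imports "HOL-Probability.Probability"
begin

text \<open>
  The cube \<open>{0,1}\<^sup>I\<close> over a finite set \<open>I\<close> of coordinates, with \<open>[n]\<close> rendered as
  \<open>{..<n}\<close>. A point is a function that is \<open>False\<close> outside \<open>I\<close>, which is the
  convention of \<^const>\<open>Pi_pmf\<close> with default value \<open>False\<close>. The dimension is a value rather
  than a type, so that a constant can be chosen uniformly in it.
\<close>

definition cube :: "nat set \<Rightarrow> (nat \<Rightarrow> bool) set" where
  "cube I = PiE_dflt I False (\<lambda>_. UNIV)"

definition biased_measure :: "nat set \<Rightarrow> real \<Rightarrow> (nat \<Rightarrow> bool) pmf" where
  "biased_measure I q = Pi_pmf I False (\<lambda>_. bernoulli_pmf q)"

definition mu :: "nat set \<Rightarrow> real \<Rightarrow> ((nat \<Rightarrow> bool) \<Rightarrow> bool) \<Rightarrow> real" where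
  "mu I q f = measure_pmf.expectation (biased_measure I q) (\<lambda>x. of_bool (f x))"

text \<open>
  The set below is empty only if \<open>f\<close> vanishes on the whole cube (for monotone \<open>f\<close>); the value of
  the infimum is then unspecified.
\<close>

definition critical_prob :: "nat \<Rightarrow> ((nat \<Rightarrow> bool) \<Rightarrow> bool) \<Rightarrow> real" where
  "critical_prob n f = Inf {q \<in> {0..1}. mu {..<n} q f \<ge> 1/2}"

text \<open>\<open>f\<^bsub>J\<rightarrow>1\<^esub>\<close>, a function on the cube over \<open>[n] - J\<close>.\<close>

definition restrict_to_1 :: "nat set \<Rightarrow> ((nat \<Rightarrow> bool) \<Rightarrow> bool) \<Rightarrow> ((nat \<Rightarrow> bool) \<Rightarrow> bool)" where
  "restrict_to_1 J f = (\<lambda>x. f (override_on x (\<lambda>_. True) J))"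

definition global_in :: "nat \<Rightarrow> real \<Rightarrow> real set \<Rightarrow> ((nat \<Rightarrow> bool) \<Rightarrow> bool) \<Rightarrow> bool" where
  "global_in n M I f \<longleftrightarrow>
     (\<forall>J q. J \<subseteq> {..<n} \<longrightarrow> real (card J) \<le> M \<longrightarrow> q \<in> I \<longrightarrow>
        mu ({..<n} - J) q (restrict_to_1 J f) \<le> mu {..<n} q f powr (1/100))"

end

(*
  Suppose that p_c > M^C p. Let J maximise mu_p(f_{J->1}) / 2^|J|. Since mu_p(f) >= e^{-M/C}, the
  set J has at most M elements, and g = f_{J->1} is spread: mu_p(g_{S->1}) <= 2^|S| mu_p(g) for
  all S. In other words, a p-random set x conditioned on g(x) contains S with probability at most
  (2p)^|S|. Spreadness forces mu_{p_c}(g) to be close to 1, which contradicts globality at p_c.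

  To see this, write a p_c-random set as the union of two independent q-random sets W and V. By a
  concentration inequality of Talagrand type, applied inside x Un W, for most (x, W) with g(x) there
  is a fragment T of x of size less than t = O(M) such that g(W Un T) holds. For fixed W, these
  fragments form a spread family of small sets, so by the second moment method V contains one of
  them with probability at least about (1 + 2p/q)^{-t}, and then g(W Un V) holds.
*)
theory Submission
  imports Defs
begin

section \<open>Biased expectations over the subsets of a finite set\<close>

text \<open>The expectation of \<open>h\<close> over a random subset of \<open>I\<close> that
  contains each element independently with probability \<open>q\<close>. As a finite sum, polynomial
  in \<open>q\<close>, it allows induction on \<open>I\<close> and continuity in
  \<open>q\<close>.\<close>

definition bexp :: "'a set \<Rightarrow> real \<Rightarrow> ('a set \<Rightarrow> real) \<Rightarrow> real" where
  "bexp I q h = (\<Sum>A\<in>Pow I. q ^ card A * (1 - q) ^ card (I - A) * h A)"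

lemma bexp_cong:
  assumes "\<And>A. A \<subseteq> I \<Longrightarrow> g A = h A"
  shows "bexp I q g = bexp I q h"
  unfolding bexp_def using assms by (intro sum.cong) auto

lemma bexp_mono:
  assumes "0 \<le> q" "q \<le> 1" "\<And>A. A \<subseteq> I \<Longrightarrow> g A \<le> h A"
  shows "bexp I q g \<le> bexp I q h"
  unfolding bexp_def using assms by (intro sum_mono mult_left_mono) auto

lemma bexp_nonneg:
  assumes "0 \<le> q" "q \<le> 1" "\<And>A. A \<subseteq> I \<Longrightarrow> 0 \<le> h A"
  shows "0 \<le> bexp I q h"
  unfolding bexp_def using assms by (intro sum_nonneg mult_nonneg_nonneg) auto

lemma bexp_add: "bexp I q (\<lambda>A. g A + h A) = bexp I q g + bexp I q h"
  by (simp add: bexp_def sum.distrib algebra_simps)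

lemma bexp_cmult: "bexp I q (\<lambda>A. c * h A) = c * bexp I q h"
  unfolding bexp_def sum_distrib_left by (intro sum.cong) auto

lemma bexp_multc: "bexp I q (\<lambda>A. h A * c) = bexp I q h * c"
  unfolding bexp_def sum_distrib_right by (intro sum.cong) auto

lemma bexp_sum: "bexp I q (\<lambda>A. \<Sum>s\<in>T. h s A) = (\<Sum>s\<in>T. bexp I q (h s))"
  unfolding bexp_def by (simp add: sum_distrib_left sum.swap[of _ T])

lemma bexp_commute:
  "bexp I p (\<lambda>x. bexp K q (\<lambda>y. h x y)) = bexp K q (\<lambda>y. bexp I p (\<lambda>x. h x y))"
  unfolding bexp_def sum_distrib_left
  by (subst sum.swap) (intro sum.cong refl, simp add: algebra_simps)

lemma bexp_empty [simp]: "bexp {} q h = h {}"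
  by (simp add: bexp_def)

text \<open>Conditioning on whether the random set contains \<open>i\<close>. This is the step of
  the inductions over the coordinates.\<close>

lemma bexp_insert:
  assumes "finite I" "i \<notin> I"
  shows "bexp (insert i I) q h = (1 - q) * bexp I q h + q * bexp I q (\<lambda>A. h (insert i A))"
proof -
  have inj: "inj_on (insert i) (Pow I)"
    using assms(2) by (auto simp: inj_on_def)
  have disj: "Pow I \<inter> insert i ` Pow I = {}"
    using assms(2) by auto
  let ?w = "\<lambda>A. q ^ card A * (1 - q) ^ card (insert i I - A) * h A"
  have "bexp (insert i I) q h = sum ?w (Pow I) + sum ?w (insert i ` Pow I)"
    unfolding bexp_def Pow_insert using assms(1) disj by (intro sum.union_disjoint) auto
  also have "sum ?w (Pow I) = (1 - q) * bexp I q h"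
    unfolding bexp_def sum_distrib_left
  proof (intro sum.cong refl)
    fix A assume A: "A \<in> Pow I"
    then have "insert i I - A = insert i (I - A)" using assms(2) by auto
    then have "card (insert i I - A) = Suc (card (I - A))"
      using assms by (simp add: finite_subset)
    then show "?w A = (1 - q) * (q ^ card A * (1 - q) ^ card (I - A) * h A)" by simp
  qed
  also have "sum ?w (insert i ` Pow I) = q * bexp I q (\<lambda>A. h (insert i A))"
    unfolding bexp_def sum_distrib_left sum.reindex[OF inj] comp_def
  proof (intro sum.cong refl)
    fix A assume A: "A \<in> Pow I"
    then have "finite A" "i \<notin> A" using assms finite_subset by auto
    moreover have "insert i I - insert i A = I - A" using assms(2) by auto
    ultimately show "?w (insert i A) = q * (q ^ card A * (1 - q) ^ card (I - A) * h (insert i A))"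
      by simp
  qed
  finally show ?thesis .
qed

lemma bexp_const:
  assumes "finite I"
  shows "bexp I q (\<lambda>_. c) = c"
  using assms by (induction rule: finite_induct) (auto simp: bexp_insert algebra_simps)

lemma bexp_le_1:
  assumes "finite I" "0 \<le> q" "q \<le> 1" "\<And>A. A \<subseteq> I \<Longrightarrow> h A \<le> 1"
  shows "bexp I q h \<le> 1"
  using bexp_mono[of q I h "\<lambda>_. 1"] assms by (simp add: bexp_const)

lemma isCont_bexp: "isCont (\<lambda>q. bexp I q h) q"
  unfolding bexp_def by (intro continuous_intros)

text \<open>The set \<open>A \<union> J\<close> does not depend on how \<open>A\<close> meets
  \<open>J\<close>, so those coordinates integrate out. This lets a restricted function be averaged
  over the full set \<open>I\<close>.\<close>

lemma bexp_ignore: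
  assumes "finite I" "J \<subseteq> I"
  shows "bexp I q (\<lambda>A. h (A \<union> J)) = bexp (I - J) q (\<lambda>A. h (A \<union> J))"
proof -
  have "finite J" using assms finite_subset by blast
  then show ?thesis using assms(2)
  proof (induction J arbitrary: h rule: finite_induct)
    case empty
    then show ?case by simp
  next
    case (insert j J)
    have I: "I - J = insert j (I - insert j J)" using insert by auto
    have "bexp I q (\<lambda>A. h (A \<union> insert j J)) = bexp (I - J) q (\<lambda>A. h (A \<union> insert j J))"
      using insert.IH[of "\<lambda>B. h (insert j B)"] insert.prems by simp
    also have "\<dots> = bexp (I - insert j J) q (\<lambda>A. h (A \<union> insert j J))"
      unfolding I using assms(1) by (subst bexp_insert) (auto simp: algebra_simps)
    finally show ?case .
  qed
qed

text \<open>On the event \<open>S \<subseteq> A\<close> the value \<open>h A\<close> equals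
  \<open>h (A \<union> S)\<close>, which is independent of the coordinates in \<open>S\<close>; the
  event itself contributes its probability.\<close>

lemma bexp_contains:
  assumes "finite I" "S \<subseteq> I"
  shows "bexp I q (\<lambda>A. of_bool (S \<subseteq> A) * h A) = q ^ card S * bexp I q (\<lambda>A. h (A \<union> S))"
proof -
  have "finite S" using assms finite_subset by blast
  then show ?thesis using assms(2)
  proof (induction S arbitrary: h rule: finite_induct)
    case empty
    then show ?case by simp
  next
    case (insert s S)
    have I: "I = insert s (I - {s})" using insert by auto
    have single: "bexp I q (\<lambda>A. of_bool (s \<in> A) * g A) = q * bexp I q (\<lambda>A. g (insert s A))" for g
    proof -
      have "bexp (I - {s}) q (\<lambda>A. of_bool (s \<in> A) * g A) = bexp (I - {s}) q (\<lambda>_. 0)"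
        by (rule bexp_cong) auto
      then have "bexp (insert s (I - {s})) q (\<lambda>A. of_bool (s \<in> A) * g A)
          = q * bexp (insert s (I - {s})) q (\<lambda>A. g (insert s A))"
        using assms(1) by (simp add: bexp_insert bexp_const algebra_simps del: insert_Diff_single)
      then show ?thesis using I by simp
    qed
    have "bexp I q (\<lambda>A. of_bool (insert s S \<subseteq> A) * h A)
        = bexp I q (\<lambda>A. of_bool (S \<subseteq> A) * (of_bool (s \<in> A) * h A))"
      by (rule bexp_cong) auto
    also have "\<dots> = q ^ card S * bexp I q (\<lambda>A. of_bool (s \<in> A \<union> S) * h (A \<union> S))"
      using insert.IH[of "\<lambda>A. of_bool (s \<in> A) * h A"] insert.prems by simp
    also have "bexp I q (\<lambda>A. of_bool (s \<in> A \<union> S) * h (A \<union> S))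
        = bexp I q (\<lambda>A. of_bool (s \<in> A) * h (A \<union> S))"
      using insert.hyps by simp
    also have "\<dots> = q * bexp I q (\<lambda>A. h (A \<union> insert s S))"
      using single[of "\<lambda>A. h (A \<union> S)"] by simp
    finally show ?case using insert.hyps by simp
  qed
qed

text \<open>Two independent random sets can be sampled by drawing their union first, and then one of
  the two sets inside the union.\<close>

lemma bexp_union:
  assumes "finite I" and z: "z = p + q - p * q" "z \<noteq> 0"
  shows "bexp I p (\<lambda>x. bexp I q (\<lambda>W. h x (x \<union> W))) = bexp I z (\<lambda>Z. bexp Z (p / z) (\<lambda>x. h x Z))"
  using assms(1)
proof (induction I arbitrary: h rule: finite_induct)
  case empty
  then show ?case by simp
next
  case (insert i I)
  let ?s = "p / z"
  define a where "a = bexp I p (\<lambda>x. bexp I q (\<lambda>W. h x (x \<union> W)))"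
  define b where "b = bexp I p (\<lambda>x. bexp I q (\<lambda>W. h x (insert i (x \<union> W))))"
  define c where "c = bexp I p (\<lambda>x. bexp I q (\<lambda>W. h (insert i x) (insert i (x \<union> W))))"
  have a: "a = bexp I z (\<lambda>Z. bexp Z ?s (\<lambda>x. h x Z))"
    unfolding a_def by (rule insert.IH)
  have b: "b = bexp I z (\<lambda>Z. bexp Z ?s (\<lambda>x. h x (insert i Z)))"
    unfolding b_def by (rule insert.IH)
  have c: "c = bexp I z (\<lambda>Z. bexp Z ?s (\<lambda>x. h (insert i x) (insert i Z)))"
    unfolding c_def by (rule insert.IH[where h = "\<lambda>x Z. h (insert i x) (insert i Z)"])
  \<comment> \<open>Here \<open>i\<close> is outside \<open>x \<union> W\<close> (term
    \<open>a\<close>), in \<open>W\<close> only (term \<open>b\<close>), or in \<open>x\<close>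
    (term \<open>c\<close>). In the last case membership in \<open>W\<close> is immaterial, so its
    two values merge.\<close>
  have "bexp (insert i I) p (\<lambda>x. bexp (insert i I) q (\<lambda>W. h x (x \<union> W)))
      = (1 - p) * ((1 - q) * a + q * b) + p * c"
    using insert.hyps unfolding a_def b_def c_def
    by (simp add: bexp_insert bexp_add bexp_cmult) (simp add: algebra_simps)
  also have "\<dots> = (1 - z) * a + (z * (1 - ?s)) * b + (z * ?s) * c"
  proof -
    have s: "z * ?s = p" "z * (1 - ?s) = q - p * q" using z by (simp_all add: right_diff_distrib)
    show ?thesis unfolding s by (simp add: z(1) algebra_simps)
  qed
  also have "\<dots> = (1 - z) * a + z * ((1 - ?s) * b + ?s * c)"
    by (simp add: algebra_simps)
  also have "(1 - ?s) * b + ?s * c = bexp I z (\<lambda>Z. bexp (insert i Z) ?s (\<lambda>x. h x (insert i Z)))"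
    unfolding b c bexp_cmult[symmetric] bexp_add[symmetric]
  proof (intro bexp_cong)
    fix Z assume "Z \<subseteq> I"
    then have "finite Z" "i \<notin> Z" using insert.hyps finite_subset by auto
    then show "bexp Z ?s (\<lambda>x. (1 - ?s) * h x (insert i Z) + ?s * h (insert i x) (insert i Z))
        = bexp (insert i Z) ?s (\<lambda>x. h x (insert i Z))"
      by (simp only: bexp_insert bexp_add bexp_cmult not_False_eq_True)
  qed
  also have "(1 - z) * a + z * \<dots> = bexp (insert i I) z (\<lambda>Z. bexp Z ?s (\<lambda>x. h x Z))"
    unfolding a using insert.hyps by (simp add: bexp_insert)
  finally show ?case .
qed

lemma bexp_union2:
  assumes "finite I" "p + q - p * q \<noteq> 0"
  shows "bexp I p (\<lambda>x. bexp I q (\<lambda>W. h (x \<union> W))) = bexp I (p + q - p * q) h"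
proof -
  have "bexp I p (\<lambda>x. bexp I q (\<lambda>W. h (x \<union> W)))
      = bexp I (p + q - p * q) (\<lambda>Z. bexp Z (p / (p + q - p * q)) (\<lambda>x. h Z))"
    by (rule bexp_union[where h = "\<lambda>x. h"]) (use assms in auto)
  also have "\<dots> = bexp I (p + q - p * q) h"
    using assms(1) by (intro bexp_cong bexp_const) (auto intro: finite_subset)
  finally show ?thesis .
qed

section \<open>A concentration inequality of Talagrand type\<close>

text \<open>The one-coordinate step of \<open>talagrand\<close>: \<open>E0\<close>,
  \<open>E1\<close> are the exponential moments over sets without and with the coordinate, and
  \<open>a\<close>, \<open>b\<close> are the measures of the two sections of \<open>F\<close>.
  Equality at \<open>u = a / b = 1 / k\<close>, \<open>E1 * b = k\<close>, \<open>E0 * b = 1\<close>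
  dictates the value of \<open>k\<close>.\<close>

lemma two_point_inequality:
  fixes r a b E0 E1 k :: real
  assumes r: "0 < r" "r \<le> 1/2" and k: "k = ((1 - r) / r)\<^sup>2"
    and ab: "0 \<le> a" "a \<le> b" and E: "0 \<le> E0" "0 \<le> E1" "E0 * b \<le> 1" "E1 * a \<le> 1" "E1 * b \<le> k"
  shows "((1 - r) * E0 + r * E1) * ((1 - r) * a + r * b) \<le> 1"
proof (cases "b = 0")
  case True
  then show ?thesis using ab by simp
next
  case False
  then have b: "b > 0" using ab by simp
  \<comment> \<open>Scaling by \<open>b\<close> reduces to \<open>b = 1\<close>: now
    \<open>e0 \<le> 1\<close>, and \<open>e1\<close> is bounded by both \<open>k\<close> and
    \<open>1 / u\<close>. The later case split is on which of these two bounds is smaller.\<close>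
  define u where "u = a / b"
  have u: "0 \<le> u" "u \<le> 1" "a = u * b" using ab b by (auto simp: u_def)
  define e0 where "e0 = E0 * b"
  define e1 where "e1 = E1 * b"
  have e: "0 \<le> e0" "e0 \<le> 1" "0 \<le> e1" "e1 * u \<le> 1" "e1 \<le> k"
    using E b by (auto simp: e0_def e1_def u_def)
  have k': "k * r\<^sup>2 = (1 - r)\<^sup>2" using r by (simp add: k power_divide)
  have kpos: "k > 0" using r k by simp
  have "((1 - r) * E0 + r * E1) * ((1 - r) * a + r * b) = ((1 - r) * e0 + r * e1) * ((1 - r) * u + r)"
    by (simp add: e0_def e1_def u algebra_simps)
  also have "\<dots> \<le> ((1 - r) + r * e1) * ((1 - r) * u + r)"
    using e u r by (intro mult_right_mono add_mono) (auto simp: mult_left_le)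
  also have "\<dots> \<le> 1"
  proof (cases "k * u \<le> 1")
    case True
    have "((1 - r) + r * e1) * ((1 - r) * u + r) \<le> ((1 - r) + r * k) * ((1 - r) * (1 / k) + r)"
    proof (intro mult_mono add_mono mult_left_mono order_refl)
      show "u \<le> 1 / k" using True kpos by (simp add: field_simps)
    qed (use e u r kpos in auto)
    also have "\<dots> = 1"
    proof -
      have "((1 - r) + r * k) * ((1 - r) * (1 / k) + r) = ((1 - r)\<^sup>2 / k + r\<^sup>2 * k) + 2 * r * (1 - r)"
        using kpos by (simp add: field_simps power2_eq_square)
      also have "(1 - r)\<^sup>2 / k = r\<^sup>2" using k' kpos by (simp add: field_simps)
      finally show ?thesis using k' by (simp add: power2_eq_square algebra_simps)
    qed
    finally show ?thesis .
  next
    case False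
    then have upos: "u > 0" using u(1) by (cases "u = 0") auto
    have "e1 \<le> 1 / u" using e upos by (simp add: field_simps)
    then have "((1 - r) + r * e1) * ((1 - r) * u + r) \<le> ((1 - r) + r * (1 / u)) * ((1 - r) * u + r)"
      using u r by (intro mult_right_mono add_mono mult_left_mono) auto
    also have "\<dots> = 1 - (1 - u) * ((1 - r)\<^sup>2 * u - r\<^sup>2) / u"
      using upos by (simp add: field_simps power2_eq_square)
    also have "\<dots> \<le> 1"
    proof -
      have "r\<^sup>2 * 1 \<le> r\<^sup>2 * (k * u)" using False r by (intro mult_left_mono) auto
      also have "r\<^sup>2 * (k * u) = k * r\<^sup>2 * u" by simp
      finally have "(1 - r)\<^sup>2 * u - r\<^sup>2 \<ge> 0" unfolding k' by simp
      then show ?thesis using u upos by simp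
    qed
    finally show ?thesis .
  qed
  finally show ?thesis .
qed

text \<open>Here \<^term>\<open>m x\<close> stands for the minimum of \<^term>\<open>card (y \<inter> x)\<close> over all \<open>y\<close> in \<open>F\<close>; requiring only
  a lower bound makes sense of it for empty \<open>F\<close> and lets the induction pass to sections of \<open>F\<close>.\<close>

lemma talagrand:
  fixes m :: "'a set \<Rightarrow> nat"
  assumes "finite I" and r: "0 < r" "r \<le> 1/2"
    and mono: "\<And>A B. F A \<Longrightarrow> A \<subseteq> B \<Longrightarrow> B \<subseteq> I \<Longrightarrow> F B"
    and m: "\<And>x y. x \<subseteq> I \<Longrightarrow> y \<subseteq> I \<Longrightarrow> F y \<Longrightarrow> m x \<le> card (y \<inter> x)"
  shows "bexp I r (\<lambda>x. (((1 - r) / r)\<^sup>2) ^ m x) * bexp I r (\<lambda>x. of_bool (F x)) \<le> 1"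
  using assms(1) mono m
proof (induction I arbitrary: F m rule: finite_induct)
  case empty
  then show ?case by (cases "F {}") auto
next
  case (insert i I)
  define k where "k = ((1 - r) / r)\<^sup>2"
  have k1: "k \<ge> 1" using r by (simp add: k_def one_le_power)
  define E0 where "E0 = bexp I r (\<lambda>x. k ^ m x)"
  define E1 where "E1 = bexp I r (\<lambda>x. k ^ m (insert i x))"
  define a where "a = bexp I r (\<lambda>x. of_bool (F x))"
  define b where "b = bexp I r (\<lambda>x. of_bool (F (insert i x)))"
  have mono: "F A \<Longrightarrow> A \<subseteq> B \<Longrightarrow> B \<subseteq> insert i I \<Longrightarrow> F B" for A B
    by (rule insert.prems(1))
  have m: "x \<subseteq> insert i I \<Longrightarrow> y \<subseteq> insert i I \<Longrightarrow> F y \<Longrightarrow> m x \<le> card (y \<inter> x)" for x y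
    by (rule insert.prems(2))
  have fin: "x \<subseteq> I \<Longrightarrow> finite x" for x using insert.hyps(1) finite_subset by blast
  have E0b: "E0 * b \<le> 1"
    unfolding E0_def b_def k_def
  proof (rule insert.IH)
    fix A B assume "F (insert i A)" "A \<subseteq> B" "B \<subseteq> I"
    then show "F (insert i B)" using mono[of "insert i A" "insert i B"] by auto
  next
    fix x y assume "x \<subseteq> I" "y \<subseteq> I" "F (insert i y)"
    moreover from this have "insert i y \<inter> x = y \<inter> x" using insert.hyps by auto
    ultimately show "m x \<le> card (y \<inter> x)" using m[of x "insert i y"] by auto
  qed
  have E1a: "E1 * a \<le> 1"
    unfolding E1_def a_def k_def
  proof (rule insert.IH)
    fix A B assume "F A" "A \<subseteq> B" "B \<subseteq> I"
    then show "F B" using mono[of A B] by auto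
  next
    fix x y assume "x \<subseteq> I" "y \<subseteq> I" "F y"
    moreover from this have "y \<inter> insert i x = y \<inter> x" using insert.hyps by auto
    ultimately show "m (insert i x) \<le> card (y \<inter> x)" using m[of "insert i x" y] by auto
  qed
  \<comment> \<open>When \<open>x\<close> and \<open>y\<close> both gain \<open>i\<close>, the
    intersection gains one point, so \<open>m\<close> has to be lowered by one at the price of a
    factor \<open>k\<close>. Truncation at \<open>m = 0\<close> is harmless because
    \<open>k \<ge> 1\<close>.\<close>
  have "bexp I r (\<lambda>x. k ^ (m (insert i x) - 1)) * b \<le> 1"
    unfolding b_def k_def
  proof (rule insert.IH)
    fix A B assume "F (insert i A)" "A \<subseteq> B" "B \<subseteq> I"
    then show "F (insert i B)" using mono[of "insert i A" "insert i B"] by auto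
  next
    fix x y assume xy: "x \<subseteq> I" "y \<subseteq> I" "F (insert i y)"
    then have "m (insert i x) \<le> card (insert i (y \<inter> x))"
      using m[of "insert i x" "insert i y"] by auto
    also have "\<dots> \<le> Suc (card (y \<inter> x))" by (rule card_insert_le_m1) auto
    finally show "m (insert i x) - 1 \<le> card (y \<inter> x)" by simp
  qed
  moreover have "E1 \<le> k * bexp I r (\<lambda>x. k ^ (m (insert i x) - 1))"
    unfolding E1_def bexp_cmult[symmetric]
  proof (rule bexp_mono)
    fix x show "k ^ m (insert i x) \<le> k * k ^ (m (insert i x) - 1)"
      using k1 by (cases "m (insert i x)") auto
  qed (use r in auto)
  moreover have "0 \<le> a"
    unfolding a_def using r by (intro bexp_nonneg) auto
  moreover have "a \<le> b"
    unfolding a_def b_def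
  proof (rule bexp_mono)
    fix A assume "A \<subseteq> I"
    then show "of_bool (F A) \<le> (of_bool (F (insert i A)) :: real)"
      using mono[of A "insert i A"] by auto
  qed (use r in auto)
  ultimately have E1b: "E1 * b \<le> k"
  proof -
    assume "bexp I r (\<lambda>x. k ^ (m (insert i x) - 1)) * b \<le> 1"
    then have "k * (bexp I r (\<lambda>x. k ^ (m (insert i x) - 1)) * b) \<le> k * 1"
      using k1 by (intro mult_left_mono) auto
    moreover assume "E1 \<le> k * bexp I r (\<lambda>x. k ^ (m (insert i x) - 1))" "0 \<le> a" "a \<le> b"
    then have "E1 * b \<le> k * bexp I r (\<lambda>x. k ^ (m (insert i x) - 1)) * b"
      by (intro mult_right_mono) auto
    ultimately show ?thesis by (simp add: mult.assoc)
  qed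
  have ab: "0 \<le> a" "a \<le> b" by fact+
  have E: "0 \<le> E0" "0 \<le> E1"
    unfolding E0_def E1_def using r k1 by (auto intro!: bexp_nonneg)
  show ?case
    using two_point_inequality[OF r k_def ab E E0b E1a E1b] insert.hyps
    unfolding k_def[symmetric] by (simp add: bexp_insert E0_def E1_def a_def b_def)
qed

text \<open>The function equal to \<open>t\<close> where every member of \<open>F\<close> meets
  \<open>x\<close> in at least \<open>t\<close> points, and \<open>0\<close> elsewhere, is
  admissible as \<open>m\<close> in \<open>talagrand\<close>. The square in \<open>k\<close> is lost
  to a square root at the end.\<close>

lemma intersecting_tail:
  assumes "finite I" and r: "0 < r" "r \<le> 1/2"
    and mono: "\<And>A B. F A \<Longrightarrow> A \<subseteq> B \<Longrightarrow> B \<subseteq> I \<Longrightarrow> F B"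
  shows "bexp I r (\<lambda>x. of_bool (F x \<and> (\<forall>y\<subseteq>I. F y \<longrightarrow> t \<le> card (y \<inter> x)))) \<le> (r / (1 - r)) ^ t"
proof -
  define H where "H = (\<lambda>x. \<forall>y\<subseteq>I. F y \<longrightarrow> t \<le> card (y \<inter> x))"
  define k where "k = ((1 - r) / r)\<^sup>2"
  define Q where "Q = bexp I r (\<lambda>x. of_bool (F x \<and> H x))"
  define P where "P = bexp I r (\<lambda>x. of_bool (F x))"
  have k1: "k \<ge> 1" using r by (simp add: k_def one_le_power)
  have Q0: "0 \<le> Q" unfolding Q_def using r by (intro bexp_nonneg) auto
  have QP: "Q \<le> P" unfolding Q_def P_def using r by (intro bexp_mono) auto
  have "k ^ t * Q \<le> bexp I r (\<lambda>x. k ^ (if H x then t else 0))"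
    unfolding Q_def bexp_cmult[symmetric] using r k1 by (intro bexp_mono) auto
  then have "k ^ t * Q * P \<le> bexp I r (\<lambda>x. k ^ (if H x then t else 0)) * P"
    using Q0 QP by (intro mult_right_mono) auto
  also have "\<dots> \<le> 1"
    unfolding k_def P_def by (rule talagrand[OF assms(1) r mono]) (auto simp: H_def)
  finally have "k ^ t * Q * P \<le> 1" .
  \<comment> \<open>\<open>Q\<close> is at most both \<open>P\<close> and \<open>1 / (k ^ t * P)\<close>, hence at most their geometric mean.\<close>
  moreover have "k ^ t * Q * Q \<le> k ^ t * Q * P"
    using QP Q0 k1 by (intro mult_left_mono) auto
  ultimately have "k ^ t * Q * Q \<le> 1" by linarith
  moreover have "k ^ t * Q * Q = (((1 - r) / r) ^ t * Q)\<^sup>2"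
    unfolding k_def by (simp only: power_mult_distrib power2_eq_square) (simp only: mult_ac)
  ultimately have "(((1 - r) / r) ^ t * Q)\<^sup>2 \<le> 1\<^sup>2" by simp
  then have "((1 - r) / r) ^ t * Q \<le> 1"
    by (rule power2_le_imp_le) simp
  then show ?thesis
    using r unfolding Q_def[symmetric, unfolded H_def] by (simp add: power_divide field_simps)
qed

section \<open>Most pairs of random sets leave a small fragment\<close>

text \<open>Given \<open>Z = x \<union> W\<close>, the set \<open>x\<close> is a random subset of \<open>Z\<close>, and each \<open>y \<subseteq> Z\<close> with \<open>G y\<close> yields
  the candidate \<open>T = y \<inter> x\<close>.\<close>

lemma fragment_tail:
  assumes "finite I" and pq: "0 < p" "p < 1" "0 < q" "q \<le> 1" "2 * p \<le> q"
    and mono: "\<And>A B. G A \<Longrightarrow> A \<subseteq> B \<Longrightarrow> B \<subseteq> I \<Longrightarrow> G B"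
  shows "bexp I p (\<lambda>x. bexp I q (\<lambda>W. of_bool (G x \<and> (\<forall>T\<subseteq>x. G (W \<union> T) \<longrightarrow> t \<le> card T))))
    \<le> (p / ((1 - p) * q)) ^ t"
proof -
  \<comment> \<open>The density of \<open>x \<union> W\<close>; given the union, \<open>x\<close>
    has density \<open>p / z\<close> inside it. The assumption \<open>2 * p \<le> q\<close> keeps
    this at most \<open>1/2\<close>, as the concentration bound demands.\<close>
  define z where "z = p + q - p * q"
  have "p * q < q" using pq by simp
  then have "z > p" by (simp add: z_def)
  then have z: "z > p" "z > 0" using pq by linarith+
  have "p * q \<le> p" using pq by (simp add: mult_left_le)
  then have zq: "z \<ge> q" by (simp add: z_def)
  have z1: "z \<le> 1"
  proof -
    have "0 \<le> (1 - p) * (1 - q)" using pq by simp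
    then show ?thesis by (simp add: z_def algebra_simps)
  qed
  have s: "0 < p / z" "p / z \<le> 1/2" using pq z zq by (auto simp: field_simps)
  let ?K = "\<lambda>x Z. G x \<and> (\<forall>y\<subseteq>Z. G y \<longrightarrow> t \<le> card (y \<inter> x))"
  have "bexp I p (\<lambda>x. bexp I q (\<lambda>W. of_bool (G x \<and> (\<forall>T\<subseteq>x. G (W \<union> T) \<longrightarrow> t \<le> card T))))
    \<le> bexp I p (\<lambda>x. bexp I q (\<lambda>W. of_bool (?K x (x \<union> W))))"
  proof (intro bexp_mono)
    fix x W assume xW: "x \<subseteq> I" "W \<subseteq> I"
    have "t \<le> card (y \<inter> x)"
      if "\<forall>T\<subseteq>x. G (W \<union> T) \<longrightarrow> t \<le> card T" "y \<subseteq> x \<union> W" "G y" for y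
    proof -
      have "G (W \<union> (y \<inter> x))" using mono[OF that(3), of "W \<union> (y \<inter> x)"] that(2) xW by auto
      then show ?thesis using that(1) by auto
    qed
    then show "of_bool (G x \<and> (\<forall>T\<subseteq>x. G (W \<union> T) \<longrightarrow> t \<le> card T)) \<le> (of_bool (?K x (x \<union> W)) :: real)"
      by auto
  qed (use pq in auto)
  also have "\<dots> = bexp I z (\<lambda>Z. bexp Z (p / z) (\<lambda>x. of_bool (?K x Z)))"
    using z by (intro bexp_union assms(1)) (auto simp: z_def)
  also have "\<dots> \<le> bexp I z (\<lambda>Z. ((p / z) / (1 - p / z)) ^ t)"
  proof (rule bexp_mono)
    fix Z assume Z: "Z \<subseteq> I"
    show "bexp Z (p / z) (\<lambda>x. of_bool (?K x Z)) \<le> ((p / z) / (1 - p / z)) ^ t"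
    proof (rule intersecting_tail)
      show "finite Z" using Z assms(1) finite_subset by blast
      show "G B" if "G A" "A \<subseteq> B" "B \<subseteq> Z" for A B
        using mono[OF that(1,2)] that(3) Z by blast
    qed (use s in auto)
  qed (use z z1 in auto)
  also have "\<dots> = ((p / z) / (1 - p / z)) ^ t" by (rule bexp_const[OF assms(1)])
  also have "(p / z) / (1 - p / z) = p / ((1 - p) * q)"
  proof -
    have "(p / z) / (1 - p / z) = p / (z - p)" using z by (simp add: field_simps)
    then show ?thesis by (simp add: z_def algebra_simps)
  qed
  finally show ?thesis .
qed

section \<open>The second moment method for spread fragments\<close>

lemma sum_power_card_Pow:
  fixes c :: real
  assumes "finite U"
  shows "(\<Sum>S\<in>Pow U. c ^ card S) = (1 + c) ^ card U"
  using assms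
proof (induction rule: finite_induct)
  case (insert i U)
  have inj: "inj_on (insert i) (Pow U)"
    using insert.hyps by (auto simp: inj_on_def)
  have "(\<Sum>S\<in>Pow (insert i U). c ^ card S)
      = (\<Sum>S\<in>Pow U. c ^ card S) + (\<Sum>S\<in>insert i ` Pow U. c ^ card S)"
    unfolding Pow_insert using insert.hyps by (intro sum.union_disjoint) auto
  also have "(\<Sum>S\<in>insert i ` Pow U. c ^ card S) = (\<Sum>S\<in>Pow U. c * c ^ card S)"
    unfolding sum.reindex[OF inj] comp_def
  proof (intro sum.cong refl)
    fix S assume "S \<in> Pow U"
    then have "finite S" "i \<notin> S" using insert.hyps finite_subset by auto
    then show "c ^ card (insert i S) = c * c ^ card S" by simp
  qed
  finally show ?case using insert by (simp add: sum_distrib_left[symmetric] algebra_simps)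
qed simp

text \<open>Spreadness of \<open>G\<close> passes to chosen fragments \<open>\<tau> x\<close>, since
  \<open>S \<subseteq> \<tau> x\<close> forces \<open>S \<subseteq> x\<close>. Large overlaps
  between two fragments are therefore rare, which bounds the second moment of the weighted number of
  fragments inside \<open>V\<close>.\<close>

lemma second_moment:
  fixes R p q :: real
  assumes fin: "finite I" and pq: "0 < p" "p \<le> 1" "0 < q" "q \<le> 1" and R: "0 \<le> R"
    and mono: "\<And>A B. G A \<Longrightarrow> A \<subseteq> B \<Longrightarrow> B \<subseteq> I \<Longrightarrow> G B"
    and spread: "\<And>S. S \<subseteq> I \<Longrightarrow>
      bexp I p (\<lambda>A. of_bool (G (A \<union> S))) \<le> R ^ card S * bexp I p (\<lambda>A. of_bool (G A))"
    and W: "W \<subseteq> I"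
  shows "bexp I p (\<lambda>x. of_bool (G x \<and> (\<exists>T\<subseteq>x. G (W \<union> T) \<and> card T < t)))
    \<le> bexp I p (\<lambda>x. of_bool (G x)) * (1 + R * p / q) ^ t * bexp I q (\<lambda>V. of_bool (G (W \<union> V)))"
proof -
  define good where "good = (\<lambda>x. G x \<and> (\<exists>T\<subseteq>x. G (W \<union> T) \<and> card T < t))"
  define g where "g = (\<lambda>x. of_bool (good x) :: real)"
  obtain \<tau> where tau: "good x \<Longrightarrow> \<tau> x \<subseteq> x \<and> G (W \<union> \<tau> x) \<and> card (\<tau> x) < t" for x
  proof -
    have "\<exists>\<tau>. \<forall>x. good x \<longrightarrow> \<tau> x \<subseteq> x \<and> G (W \<union> \<tau> x) \<and> card (\<tau> x) < t"
      by (intro choice) (auto simp: good_def)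
    then show ?thesis using that by blast
  qed
  define P where "P = bexp I p (\<lambda>x. of_bool (G x))"
  define N where "N = bexp I p g"
  define D where "D = (1 + R * p / q) ^ t"
  \<comment> \<open>The weighted number of fragments inside \<open>V\<close>, normalised to have mean \<open>N\<close>.\<close>
  define X where "X = (\<lambda>V. bexp I p (\<lambda>x. g x * (of_bool (\<tau> x \<subseteq> V) / q ^ card (\<tau> x))))"
  define Pr where "Pr = bexp I q (\<lambda>V. of_bool (G (W \<union> V)))"
  have P0: "0 \<le> P" unfolding P_def using pq by (intro bexp_nonneg) auto
  have D1: "1 \<le> D" unfolding D_def using pq R by (intro one_le_power) auto
  have EX: "bexp I q X = N"
    unfolding X_def bexp_commute[of I q] N_def
  proof (rule bexp_cong)
    fix x assume x: "x \<subseteq> I"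
    show "bexp I q (\<lambda>V. g x * (of_bool (\<tau> x \<subseteq> V) / q ^ card (\<tau> x))) = g x"
    proof (cases "good x")
      case True
      then have "\<tau> x \<subseteq> I" using tau x by blast
      then have "bexp I q (\<lambda>V. of_bool (\<tau> x \<subseteq> V) * 1) = q ^ card (\<tau> x)"
        using fin by (simp only: bexp_contains bexp_const)
      then show ?thesis using pq by (simp add: bexp_cmult bexp_multc divide_inverse)
    qed (simp add: g_def bexp_const[OF fin])
  qed
  have small: "bexp I p (\<lambda>x. g x * of_bool (S \<subseteq> \<tau> x)) \<le> (R * p) ^ card S * P" if "S \<subseteq> I" for S
  proof -
    have "bexp I p (\<lambda>x. g x * of_bool (S \<subseteq> \<tau> x)) \<le> bexp I p (\<lambda>x. of_bool (S \<subseteq> x) * of_bool (G x))"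
    proof (rule bexp_mono)
      fix x show "g x * of_bool (S \<subseteq> \<tau> x) \<le> of_bool (S \<subseteq> x) * of_bool (G x)"
        using tau[of x] by (auto simp: g_def good_def)
    qed (use pq in auto)
    also have "\<dots> = p ^ card S * bexp I p (\<lambda>A. of_bool (G (A \<union> S)))"
      by (rule bexp_contains[OF fin that])
    also have "\<dots> \<le> p ^ card S * (R ^ card S * P)"
      unfolding P_def using spread[OF that] pq by (intro mult_left_mono) auto
    finally show ?thesis by (simp add: power_mult_distrib algebra_simps)
  qed
  \<comment> \<open>Two normalised inclusion events have correlation
    \<open>(1 / q) ^ card (T \<inter> T')\<close>. Bounding this by a sum over common subsets
    \<open>S\<close> lets \<open>small\<close> be applied to each \<open>S\<close>; resumming over
    \<open>S \<subseteq> \<tau> x\<close> then produces the factor \<open>D\<close>.\<close>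
  have pair: "bexp I q (\<lambda>V. (of_bool (T \<subseteq> V) / q ^ card T) * (of_bool (T' \<subseteq> V) / q ^ card T'))
      \<le> (\<Sum>S\<in>Pow T. of_bool (S \<subseteq> T') * (1 / q) ^ card S)" if T: "T \<subseteq> I" "T' \<subseteq> I" for T T'
  proof -
    have f: "finite T" "finite T'" using T fin finite_subset by auto
    have "bexp I q (\<lambda>V. (of_bool (T \<subseteq> V) / q ^ card T) * (of_bool (T' \<subseteq> V) / q ^ card T'))
        = bexp I q (\<lambda>V. (1 / (q ^ card T * q ^ card T')) * (of_bool (T \<union> T' \<subseteq> V) * 1))"
      by (rule bexp_cong) auto
    also have "\<dots> = (1 / (q ^ card T * q ^ card T')) * q ^ card (T \<union> T')"
      unfolding bexp_cmult using T fin by (subst bexp_contains) (auto simp: bexp_const)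
    also have "\<dots> = (1 / q) ^ card (T \<inter> T')"
    proof -
      have "q ^ card T * q ^ card T' = q ^ card (T \<union> T') * q ^ card (T \<inter> T')"
        using card_Un_Int[OF f] by (simp flip: power_add)
      then show ?thesis using pq by (simp add: power_one_over)
    qed
    also have "\<dots> \<le> (1 + 1 / q) ^ card (T \<inter> T')"
      using pq by (intro power_mono) auto
    also have "\<dots> = (\<Sum>S\<in>Pow (T \<inter> T'). (1 / q) ^ card S)"
      by (rule sum_power_card_Pow[symmetric]) (use f in auto)
    also have "\<dots> = (\<Sum>S\<in>Pow (T \<inter> T'). of_bool (S \<subseteq> T') * (1 / q) ^ card S)"
      by (intro sum.cong) auto
    also have "\<dots> \<le> (\<Sum>S\<in>Pow T. of_bool (S \<subseteq> T') * (1 / q) ^ card S)"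
      using f pq by (intro sum_mono2) auto
    finally show ?thesis .
  qed
  have "bexp I q (\<lambda>V. X V * X V)
      = bexp I p (\<lambda>x. bexp I p (\<lambda>y. g x * g y * bexp I q (\<lambda>V.
          (of_bool (\<tau> x \<subseteq> V) / q ^ card (\<tau> x)) * (of_bool (\<tau> y \<subseteq> V) / q ^ card (\<tau> y)))))"
  proof -
    have "bexp I q (\<lambda>V. X V * X V) = bexp I q (\<lambda>V. bexp I p (\<lambda>x. bexp I p (\<lambda>y.
        g x * g y * ((of_bool (\<tau> x \<subseteq> V) / q ^ card (\<tau> x)) * (of_bool (\<tau> y \<subseteq> V) / q ^ card (\<tau> y))))))"
      unfolding X_def bexp_cmult[symmetric] bexp_multc[symmetric]
      by (intro bexp_cong) (simp add: algebra_simps)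
    then show ?thesis
      by (simp only: bexp_commute[of I q] bexp_cmult)
  qed
  also have "\<dots> \<le> bexp I p (\<lambda>x. g x * (P * D))"
  proof (rule bexp_mono)
    fix x assume x: "x \<subseteq> I"
    show "bexp I p (\<lambda>y. g x * g y * bexp I q (\<lambda>V.
          (of_bool (\<tau> x \<subseteq> V) / q ^ card (\<tau> x)) * (of_bool (\<tau> y \<subseteq> V) / q ^ card (\<tau> y))))
        \<le> g x * (P * D)"
    proof (cases "good x")
      case gx: True
      then have tx: "\<tau> x \<subseteq> I" "card (\<tau> x) < t" using tau x by blast+
      then have ftx: "finite (\<tau> x)" using fin finite_subset by blast
      have "bexp I p (\<lambda>y. g x * g y * bexp I q (\<lambda>V.
          (of_bool (\<tau> x \<subseteq> V) / q ^ card (\<tau> x)) * (of_bool (\<tau> y \<subseteq> V) / q ^ card (\<tau> y))))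
        \<le> bexp I p (\<lambda>y. \<Sum>S\<in>Pow (\<tau> x). (1 / q) ^ card S * (g y * of_bool (S \<subseteq> \<tau> y)))"
      proof (rule bexp_mono)
        fix y assume y: "y \<subseteq> I"
        show "g x * g y * bexp I q (\<lambda>V.
          (of_bool (\<tau> x \<subseteq> V) / q ^ card (\<tau> x)) * (of_bool (\<tau> y \<subseteq> V) / q ^ card (\<tau> y)))
          \<le> (\<Sum>S\<in>Pow (\<tau> x). (1 / q) ^ card S * (g y * of_bool (S \<subseteq> \<tau> y)))"
        proof (cases "good y")
          case True
          then have "\<tau> y \<subseteq> I" using tau y by blast
          then show ?thesis using pair[OF tx(1), of "\<tau> y"] gx True
            by (simp add: g_def mult.commute)
        qed (simp add: g_def)
      qed (use pq in auto)
      also have "\<dots> = (\<Sum>S\<in>Pow (\<tau> x). (1 / q) ^ card S * bexp I p (\<lambda>y. g y * of_bool (S \<subseteq> \<tau> y)))"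
        by (simp only: bexp_sum bexp_cmult)
      also have "\<dots> \<le> (\<Sum>S\<in>Pow (\<tau> x). (1 / q) ^ card S * ((R * p) ^ card S * P))"
        using small tx pq by (intro sum_mono mult_left_mono) auto
      also have "\<dots> = (\<Sum>S\<in>Pow (\<tau> x). (R * p / q) ^ card S) * P"
        unfolding sum_distrib_right
        by (intro sum.cong) (auto simp: power_divide power_mult_distrib)
      also have "\<dots> = (1 + R * p / q) ^ card (\<tau> x) * P"
        using ftx by (simp add: sum_power_card_Pow)
      also have "\<dots> \<le> D * P"
        unfolding D_def using tx pq R P0 by (intro mult_right_mono power_increasing) auto
      finally show ?thesis using gx by (simp add: g_def mult.commute)
    qed (simp add: g_def bexp_const[OF fin])
  qed (use pq in auto)
  also have "\<dots> = N * (P * D)" by (simp only: bexp_multc N_def)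
  finally have EX2: "bexp I q (\<lambda>V. X V * X V) \<le> N * (P * D)" .
  \<comment> \<open>The Cauchy-Schwarz step of the second moment method, in the form
    \<open>2 \<lambda> X \<le> X\<^sup>2 + \<lambda>\<^sup>2\<close> with \<open>\<lambda> = P D\<close>.\<close>
  have "bexp I q (\<lambda>V. 2 * (P * D) * X V)
      \<le> bexp I q (\<lambda>V. X V * X V + (P * D)\<^sup>2 * of_bool (G (W \<union> V)))"
  proof (rule bexp_mono)
    fix V assume V: "V \<subseteq> I"
    show "2 * (P * D) * X V \<le> X V * X V + (P * D)\<^sup>2 * of_bool (G (W \<union> V))"
    proof (cases "G (W \<union> V)")
      case True
      have "0 \<le> (X V - P * D)\<^sup>2" by simp
      then show ?thesis using True by (simp add: power2_eq_square algebra_simps)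
    next
      case False
      \<comment> \<open>By monotonicity a fragment inside \<open>V\<close> would already give
        \<open>G (W \<union> V)\<close>, so no fragment contributes.\<close>
      have "X V = bexp I p (\<lambda>_. 0)"
        unfolding X_def
      proof (rule bexp_cong)
        fix x assume "x \<subseteq> I"
        have "\<not> (good x \<and> \<tau> x \<subseteq> V)"
          using tau[of x] mono[of "W \<union> \<tau> x" "W \<union> V"] False V W by auto
        then show "g x * (of_bool (\<tau> x \<subseteq> V) / q ^ card (\<tau> x)) = 0" by (auto simp: g_def)
      qed
      then show ?thesis by (simp add: bexp_const[OF fin])
    qed
  qed (use pq in auto)
  then have "2 * (P * D) * N \<le> bexp I q (\<lambda>V. X V * X V) + (P * D)\<^sup>2 * Pr"
    by (simp only: bexp_add bexp_cmult EX Pr_def)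
  then have "2 * (P * D) * N \<le> N * (P * D) + (P * D)\<^sup>2 * Pr"
    using EX2 by linarith
  then have "(P * D) * N \<le> (P * D) * (P * D * Pr)"
    by (simp add: power2_eq_square algebra_simps)
  then have "N \<le> P * D * Pr" if "P \<noteq> 0"
    using that P0 D1 by (simp add: mult_le_cancel_left_pos)
  moreover have "N \<le> P" unfolding N_def P_def g_def using pq by (intro bexp_mono) (auto simp: good_def)
  ultimately have "N \<le> P * D * Pr" by (cases "P = 0") auto
  then show ?thesis by (simp add: N_def P_def D_def Pr_def g_def good_def)
qed

section \<open>From spreadness to measure close to one\<close>

text \<open>Split on whether \<open>x\<close> has a fragment of size below \<open>t\<close> over
  \<open>W\<close>. \<open>fragment_tail\<close> bounds the failures; \<open>second_moment\<close>
  handles the rest for each fixed \<open>W\<close>, and averaging over \<open>W\<close> turns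
  \<open>W \<union> V\<close> into one random set of density \<open>q + q - q * q\<close>.\<close>

lemma spread_imp_likely:
  fixes R p q :: real
  assumes fin: "finite I" and pq: "0 < p" "p < 1" "0 < q" "q \<le> 1" "2 * p \<le> q" and R: "0 \<le> R"
    and mono: "\<And>A B. G A \<Longrightarrow> A \<subseteq> B \<Longrightarrow> B \<subseteq> I \<Longrightarrow> G B"
    and spread: "\<And>S. S \<subseteq> I \<Longrightarrow>
      bexp I p (\<lambda>A. of_bool (G (A \<union> S))) \<le> R ^ card S * bexp I p (\<lambda>A. of_bool (G A))"
  shows "bexp I p (\<lambda>x. of_bool (G x)) - (p / ((1 - p) * q)) ^ t
    \<le> bexp I p (\<lambda>x. of_bool (G x)) * (1 + R * p / q) ^ t
       * bexp I (q + q - q * q) (\<lambda>V. of_bool (G V))"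
proof -
  let ?P = "bexp I p (\<lambda>x. of_bool (G x))"
  let ?bad = "\<lambda>x W. G x \<and> (\<forall>T\<subseteq>x. G (W \<union> T) \<longrightarrow> t \<le> card T)"
  let ?good = "\<lambda>x W. G x \<and> (\<exists>T\<subseteq>x. G (W \<union> T) \<and> card T < t)"
  have "?P = bexp I q (\<lambda>W. ?P)" by (simp add: bexp_const[OF fin])
  also have "\<dots> = bexp I q (\<lambda>W. bexp I p (\<lambda>x. of_bool (?bad x W) + of_bool (?good x W)))"
    by (intro bexp_cong) (auto simp: not_le)
  also have "\<dots> = bexp I p (\<lambda>x. bexp I q (\<lambda>W. of_bool (?bad x W)))
      + bexp I q (\<lambda>W. bexp I p (\<lambda>x. of_bool (?good x W)))"
    by (simp only: bexp_add bexp_commute[of I p])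
  also have "bexp I p (\<lambda>x. bexp I q (\<lambda>W. of_bool (?bad x W))) \<le> (p / ((1 - p) * q)) ^ t"
    by (rule fragment_tail) (use assms in auto)
  also have "bexp I q (\<lambda>W. bexp I p (\<lambda>x. of_bool (?good x W)))
      \<le> bexp I q (\<lambda>W. ?P * (1 + R * p / q) ^ t * bexp I q (\<lambda>V. of_bool (G (W \<union> V))))"
    using second_moment[OF fin _ _ _ _ R mono spread] pq by (intro bexp_mono) auto
  also have "\<dots> = ?P * (1 + R * p / q) ^ t * bexp I (q + q - q * q) (\<lambda>V. of_bool (G V))"
  proof -
    have "q * q \<le> q" using pq by (simp add: mult_left_le)
    then have "q + q - q * q \<noteq> 0" using pq by linarith
    then have "bexp I q (\<lambda>W. bexp I q (\<lambda>V. of_bool (G (W \<union> V))))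
        = bexp I (q + q - q * q) (\<lambda>V. of_bool (G V))"
      by (rule bexp_union2[OF fin])
    then show ?thesis by (simp only: bexp_cmult)
  qed
  finally show ?thesis by simp
qed

text \<open>Take \<open>J\<close> maximising the measure of the restriction divided by
  \<open>2 ^ card J\<close>. Comparison with the empty set gives the growth bound, and comparison
  with \<open>S \<union> J\<close> gives spreadness.\<close>

lemma exists_spread_restriction:
  fixes F :: "'a set \<Rightarrow> bool"
  assumes fin: "finite I"
  obtains J where "J \<subseteq> I"
    "2 ^ card J * bexp I p (\<lambda>A. of_bool (F A)) \<le> bexp I p (\<lambda>A. of_bool (F (A \<union> J)))"
    "\<And>S. S \<subseteq> I \<Longrightarrow> 0 \<le> p \<Longrightarrow> p \<le> 1 \<Longrightarrow> bexp I p (\<lambda>A. of_bool (F (A \<union> S \<union> J)))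
      \<le> 2 ^ card S * bexp I p (\<lambda>A. of_bool (F (A \<union> J)))"
proof -
  define \<phi> where "\<phi> = (\<lambda>J. bexp I p (\<lambda>A. of_bool (F (A \<union> J))) / 2 ^ card J)"
  have "finite (\<phi> ` Pow I)" "\<phi> ` Pow I \<noteq> {}" using fin by auto
  then have "Max (\<phi> ` Pow I) \<in> \<phi> ` Pow I" by (rule Max_in)
  then obtain J where J: "J \<subseteq> I" "\<phi> J = Max (\<phi> ` Pow I)" by auto
  have max: "\<phi> K \<le> \<phi> J" if "K \<subseteq> I" for K
    using J that fin by (auto intro!: Max_ge)
  show thesis
  proof (rule that[OF J(1)])
    show "2 ^ card J * bexp I p (\<lambda>A. of_bool (F A)) \<le> bexp I p (\<lambda>A. of_bool (F (A \<union> J)))"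
      using max[of "{}"] by (simp add: \<phi>_def field_simps)
    fix S assume S: "S \<subseteq> I" and p: "0 \<le> p" "p \<le> 1"
    let ?b = "bexp I p (\<lambda>A. of_bool (F (A \<union> J)))"
    have b: "0 \<le> ?b" using p by (intro bexp_nonneg) auto
    have "bexp I p (\<lambda>A. of_bool (F (A \<union> S \<union> J))) = \<phi> (S \<union> J) * 2 ^ card (S \<union> J)"
      by (simp add: \<phi>_def Un_assoc)
    also have "\<dots> \<le> \<phi> J * 2 ^ card (S \<union> J)"
      using max[of "S \<union> J"] S J(1) by (intro mult_right_mono) auto
    also have "\<dots> \<le> \<phi> J * 2 ^ (card S + card J)"
      using b by (intro mult_left_mono power_increasing card_Un_le) (auto simp: \<phi>_def)
    also have "\<dots> = 2 ^ card S * ?b" by (simp add: \<phi>_def power_add)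
    finally show "bexp I p (\<lambda>A. of_bool (F (A \<union> S \<union> J))) \<le> 2 ^ card S * ?b" .
  qed
qed

text \<open>The choice of parameters in \<open>spread_imp_likely\<close>: \<open>t\<close> must be
  large enough that the tail is a small fraction of \<open>P\<close>, yet \<open>t * p / q\<close>
  must be small so that the second moment loss \<open>D\<close> is close to one.\<close>

lemma spread_imp_almost_sure:
  fixes c p M :: real
  assumes fin: "finite I" and p: "0 < p" and c: "c \<le> 1" "M ^ 4 * p \<le> c" and M: "66 \<le> M"
    and mono: "\<And>A B. G A \<Longrightarrow> A \<subseteq> B \<Longrightarrow> B \<subseteq> I \<Longrightarrow> G B"
    and spread: "\<And>S. S \<subseteq> I \<Longrightarrow>
      bexp I p (\<lambda>A. of_bool (G (A \<union> S))) \<le> 2 ^ card S * bexp I p (\<lambda>A. of_bool (G A))"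
    and large: "exp (- M / 100) \<le> bexp I p (\<lambda>A. of_bool (G A))"
  shows "0.998 \<le> bexp I c (\<lambda>A. of_bool (G A))"
proof -
  define P where "P = bexp I p (\<lambda>A. of_bool (G A))"
  have P: "P > 0" using large by (auto simp: P_def intro: less_le_trans[OF exp_gt_zero])
  \<comment> \<open>The part \<open>M / 100\<close> matches the lower bound on \<open>P\<close>, and
    the extra 10 gains a factor \<open>exp (- 10)\<close>, below 1/1000.\<close>
  define t where "t = nat \<lceil>M / 100 + 10\<rceil>"
  have t: "M / 100 + 10 \<le> real t" "real t \<le> M / 100 + 11"
    using M unfolding t_def by linarith+
  then have tM: "real t \<le> M" "1 \<le> real t" using M by auto
  have c0: "0 < c" using c p M by (meson less_le_trans mult_pos_pos zero_less_power zero_less_numeral)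
  \<comment> \<open>The density for which two independent random sets have a union of density
    \<open>c\<close>.\<close>
  define q where "q = 1 - sqrt (1 - c)"
  have q1: "q \<le> 1" using c by (simp add: q_def)
  have "sqrt (1 - c) \<le> 1 - c / 2"
    using c by (intro real_le_lsqrt) (auto simp: power2_eq_square algebra_simps)
  then have qc: "c / 2 \<le> q" by (simp add: q_def)
  have "sqrt (1 - c) * sqrt (1 - c) = 1 - c" using c by simp
  then have cq: "q + q - q * q = c" by (simp add: q_def algebra_simps)
  \<comment> \<open>Since \<open>t \<le> M\<close>, the fourth power dominates
    \<open>4000 * t\<close>; with \<open>c / 2 \<le> q\<close> this makes
    \<open>2 * t * p / q\<close> at most 1/1000.\<close>
  have "66 ^ 3 * M \<le> M ^ 3 * M" using M by (intro mult_right_mono power_mono) auto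
  moreover have "M ^ 3 * M = M ^ 4" by (simp add: eval_nat_numeral)
  ultimately have "4000 * real t \<le> M ^ 4" using tM M by simp
  then have "4000 * real t * p \<le> M ^ 4 * p" using p by (intro mult_right_mono) auto
  then have tq: "2000 * real t * p \<le> q" using c qc by linarith
  have "2000 * 1 * p \<le> 2000 * real t * p" using tM p by (intro mult_right_mono) auto
  then have pq: "2000 * p \<le> q" using tq by linarith
  then have p1: "p \<le> 1/2" "q > 0" using q1 p by linarith+
  have eps: "p / ((1 - p) * q) \<le> exp (- 1)"
  proof -
    have "exp 1 * p \<le> 3 * p" using exp_le p by (intro mult_right_mono) auto
    also have "\<dots> \<le> 1/2 * q" using pq p by linarith
    also have "\<dots> \<le> (1 - p) * q" using p1 by (intro mult_right_mono) auto
    finally show ?thesis using p1 p by (simp add: exp_minus field_simps)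
  qed
  have "(p / ((1 - p) * q)) ^ t \<le> exp (- 1) ^ t"
    using eps p p1 by (intro power_mono) auto
  also have "\<dots> = exp (- real t)" by (simp flip: exp_of_nat_mult)
  also have "\<dots> \<le> exp (- M / 100 + - 10)" using t by simp
  also have "\<dots> = exp (- M / 100) * exp (- 10)" by (rule exp_add)
  also have "\<dots> \<le> P * (1 / 1000)"
  proof (intro mult_mono)
    have "(2::real) ^ 10 \<le> exp 1 ^ 10"
      using exp_ge_add_one_self[of 1] by (intro power_mono) auto
    also have "\<dots> = exp 10" by (simp flip: exp_of_nat_mult)
    finally show "exp (- 10) \<le> (1 / 1000 :: real)" by (simp add: exp_minus field_simps)
  qed (use large P in \<open>auto simp: P_def\<close>)
  finally have tail: "(p / ((1 - p) * q)) ^ t \<le> P * (1 / 1000)" .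
  define D where "D = (1 + 2 * p / q) ^ t"
  have D0: "D > 0" using p p1 by (auto simp: D_def intro!: zero_less_power add_pos_nonneg)
  have "D \<le> exp (2 * p / q) ^ t"
    unfolding D_def using p p1 by (intro power_mono exp_ge_add_one_self) auto
  also have "\<dots> = exp (real t * (2 * p / q))" by (simp flip: exp_of_nat_mult)
  also have "\<dots> \<le> exp (1 / 1000)" using tq p1 by (simp add: field_simps)
  finally have D: "exp (- (1 / 1000)) \<le> 1 / D" using D0 by (simp add: exp_minus field_simps)
  define X where "X = bexp I c (\<lambda>A. of_bool (G A))"
  have "P - P * (1 / 1000) \<le> P - (p / ((1 - p) * q)) ^ t" using tail by simp
  also have "\<dots> \<le> P * D * X"
    using spread_imp_likely[OF fin p _ p1(2) q1 _ _ mono spread, where t = t] pq p p1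
    unfolding P_def D_def X_def cq by auto
  finally have "P * (999 / 1000) \<le> P * (D * X)" by (simp add: algebra_simps)
  then have "999 / 1000 \<le> D * X" using P by simp
  then have "999 / 1000 * (1 / D) \<le> X" using D0 by (simp add: field_simps)
  moreover have "999 / 1000 * (999 / 1000) \<le> 999 / 1000 * (1 / D)"
    using D exp_ge_add_one_self[of "- (1 / 1000)"] by simp
  ultimately show ?thesis unfolding X_def by simp
qed

section \<open>The measure \<open>mu\<close> and the critical probability in terms of random
  sets\<close>

lemma cube_eq: "cube I = (\<lambda>A i. i \<in> A) ` Pow I"
proof
  show "cube I \<subseteq> (\<lambda>A i. i \<in> A) ` Pow I"
  proof
    fix x assume "x \<in> cube I"
    then have "{i. x i} \<subseteq> I" "x = (\<lambda>i. i \<in> {i. x i})" by (auto simp: cube_def PiE_dflt_def)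
    then show "x \<in> (\<lambda>A i. i \<in> A) ` Pow I" by blast
  qed
qed (auto simp: cube_def PiE_dflt_def)

lemma set_biased_measure_subset: "finite I \<Longrightarrow> set_pmf (biased_measure I q) \<subseteq> cube I"
  unfolding biased_measure_def cube_def
  by (auto simp: set_Pi_pmf PiE_dflt_def)

lemma mu_eq_bexp:
  assumes fin: "finite I" and q: "0 \<le> q" "q \<le> 1"
  shows "mu I q f = bexp I q (\<lambda>A. of_bool (f (\<lambda>i. i \<in> A)))"
proof -
  have "mu I q f = (\<Sum>x\<in>cube I. of_bool (f x) * pmf (biased_measure I q) x)"
    unfolding mu_def using fin set_biased_measure_subset[OF fin]
    by (intro integral_measure_pmf_real) (auto simp: cube_eq)
  also have "\<dots> = (\<Sum>A\<in>Pow I. of_bool (f (\<lambda>i. i \<in> A)) * pmf (biased_measure I q) (\<lambda>i. i \<in> A))"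
    unfolding cube_eq by (subst sum.reindex) (auto simp: inj_on_def fun_eq_iff)
  also have "\<dots> = bexp I q (\<lambda>A. of_bool (f (\<lambda>i. i \<in> A)))"
    unfolding bexp_def
  proof (intro sum.cong refl)
    fix A assume "A \<in> Pow I"
    then have A: "A \<subseteq> I" by simp
    have "pmf (biased_measure I q) (\<lambda>i. i \<in> A) = (\<Prod>i\<in>I. if i \<in> A then q else 1 - q)"
      unfolding biased_measure_def using fin A q
      by (subst pmf_Pi') (auto intro!: prod.cong)
    also have "\<dots> = q ^ card A * (1 - q) ^ card (I - A)"
      using fin A by (simp add: prod.If_cases Int_absorb1 Diff_eq)
    finally show "of_bool (f (\<lambda>i. i \<in> A)) * pmf (biased_measure I q) (\<lambda>i. i \<in> A)
        = q ^ card A * (1 - q) ^ card (I - A) * of_bool (f (\<lambda>i. i \<in> A))" by simp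
  qed
  finally show ?thesis .
qed

lemma mu_restrict_to_1:
  assumes fin: "finite I" and J: "J \<subseteq> I" and q: "0 \<le> q" "q \<le> 1"
  shows "mu (I - J) q (restrict_to_1 J f) = bexp I q (\<lambda>A. of_bool (f (\<lambda>i. i \<in> (A \<union> J) \<inter> I)))"
proof -
  have "mu (I - J) q (restrict_to_1 J f) = bexp (I - J) q (\<lambda>A. of_bool (f (\<lambda>i. i \<in> (A \<union> J) \<inter> I)))"
    using fin q unfolding mu_eq_bexp[OF finite_Diff[OF fin] q]
  proof (intro bexp_cong)
    fix A assume "A \<subseteq> I - J"
    then have "override_on (\<lambda>i. i \<in> A) (\<lambda>_. True) J = (\<lambda>i. i \<in> (A \<union> J) \<inter> I)"
      using J by (auto simp: override_on_def fun_eq_iff)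
    then show "of_bool (restrict_to_1 J f (\<lambda>i. i \<in> A)) = (of_bool (f (\<lambda>i. i \<in> (A \<union> J) \<inter> I)) :: real)"
      by (simp add: restrict_to_1_def)
  qed
  then show ?thesis
    using bexp_ignore[OF fin J, of q "\<lambda>A. of_bool (f (\<lambda>i. i \<in> A \<inter> I))"] by simp
qed

text \<open>Stated for arbitrary \<open>q\<close>, because \<open>p \<le> 1\<close> is only
  available after \<open>critical_prob_bounds\<close>, which itself rests on satisfiability.\<close>

lemma mu_pos_imp_satisfiable:
  assumes "finite I" "mu I q f > 0"
  shows "\<exists>x\<in>cube I. f x"
proof (rule ccontr)
  assume "\<not> ?thesis"
  then have "\<forall>x\<in>set_pmf (biased_measure I q). of_bool (f x) = (0::real)"
    using set_biased_measure_subset[OF assms(1), of q] by auto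
  then have "mu I q f = measure_pmf.expectation (biased_measure I q) (\<lambda>_. 0)"
    unfolding mu_def by (intro integral_cong_AE) (auto simp: AE_measure_pmf_iff)
  then show False using assms(2) by simp
qed

lemma mu_1:
  assumes "finite I" "mono_on (cube I) f" "x \<in> cube I" "f x"
  shows "mu I 1 f = 1"
proof -
  have top: "(\<lambda>i. i \<in> I) \<in> cube I" by (auto simp: cube_eq)
  have "x \<le> (\<lambda>i. i \<in> I)" using assms(3) by (auto simp: cube_eq le_fun_def)
  then have "f (\<lambda>i. i \<in> I)" using mono_onD[OF assms(2,3) top] assms(4) by auto
  then have "bexp I 1 (\<lambda>A. of_bool (I \<subseteq> A) * 1) \<le> bexp I 1 (\<lambda>A. of_bool (f (\<lambda>i. i \<in> A)))"
    by (intro bexp_mono) (auto dest: subset_antisym)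
  then have "1 \<le> mu I 1 f"
    using assms(1) by (simp only: bexp_contains bexp_const) (simp add: mu_eq_bexp)
  moreover have "mu I 1 f \<le> 1"
    using assms(1) by (simp add: mu_eq_bexp bexp_le_1)
  ultimately show ?thesis by simp
qed

lemma critical_prob_bounds:
  assumes "mono_on (cube {..<n}) f" "mu {..<n} q f > 0"
  shows "0 \<le> critical_prob n f" "critical_prob n f \<le> 1"
proof -
  let ?S = "{q \<in> {0..1}. mu {..<n} q f \<ge> 1/2}"
  have "mu {..<n} 1 f = 1"
    using mu_pos_imp_satisfiable[OF _ assms(2)] mu_1[OF _ assms(1)] by auto
  then have "1 \<in> ?S" by simp
  then show "critical_prob n f \<le> 1" "0 \<le> critical_prob n f"
    unfolding critical_prob_def
    by (auto intro!: cInf_lower cInf_greatest bdd_belowI[of _ 0])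
qed

text \<open>Below the infimum this is its defining property; at the infimum it follows by a left
  limit, the measure being polynomial in the bias.\<close>

lemma mu_le_half:
  assumes "0 \<le> q" "q \<le> critical_prob n f" "0 < critical_prob n f" "critical_prob n f \<le> 1"
  shows "mu {..<n} q f \<le> 1/2"
proof -
  let ?c = "critical_prob n f"
  have below: "mu {..<n} r f \<le> 1/2" if "0 \<le> r" "r < ?c" for r
  proof (rule ccontr)
    assume "\<not> ?thesis"
    then have "r \<in> {q \<in> {0..1}. mu {..<n} q f \<ge> 1/2}" using that assms by auto
    then have "?c \<le> r" unfolding critical_prob_def by (auto intro!: cInf_lower bdd_belowI[of _ 0])
    then show False using that by simp
  qed
  let ?b = "\<lambda>r. bexp {..<n} r (\<lambda>A. of_bool (f (\<lambda>i. i \<in> A)))"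
  have "(?b \<longlongrightarrow> ?b ?c) (at_left ?c)"
    using isCont_bexp[of ?c "{..<n}"] by (auto simp: isCont_def intro: filterlim_mono at_le)
  moreover have "\<forall>\<^sub>F r in at_left ?c. ?b r \<le> 1/2"
  proof (rule eventually_at_leftI[of 0])
    fix r assume "r \<in> {0<..<?c}"
    then show "?b r \<le> 1/2" using below[of r] assms by (simp add: mu_eq_bexp)
  qed (use assms in auto)
  ultimately have "?b ?c \<le> 1/2" by (rule tendsto_upperbound) simp
  then show ?thesis using below[of q] assms by (cases "q = ?c") (auto simp: mu_eq_bexp)
qed

text \<open>Bernoulli's inequality gives \<open>0.998 ^ 100 \<ge> 0.8 > 1/2\<close>.\<close>

lemma half_powr_less: "(1 / 2 :: real) powr (1 / 100) < 0.998"
proof (rule ccontr)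
  assume "\<not> ?thesis"
  then have "(0.998 :: real) ^ 100 \<le> ((1 / 2) powr (1 / 100)) ^ 100"
    by (intro power_mono) auto
  also have "\<dots> = 1 / 2" by (simp add: powr_powr flip: powr_realpow)
  finally show False using Bernoulli_inequality[of "- 0.002 :: real" 100] by simp
qed

section \<open>The contradiction with globality at the critical probability\<close>

theorem theorem1p6:
  "\<exists>C::real. C > 0 \<and>
     (\<forall>(n::nat) (f :: (nat \<Rightarrow> bool) \<Rightarrow> bool) (p::real) (M::real).
        mono_on (cube {..<n}) f \<longrightarrow>
        0 \<le> p \<longrightarrow> p \<le> critical_prob n f \<longrightarrow> M > 0 \<longrightarrow>
        global_in n M {p..critical_prob n f} f \<longrightarrow>
        mu {..<n} p f \<ge> exp (- M / C) \<longrightarrow>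
        critical_prob n f \<le> M powr C * p)"
proof (intro exI[of _ 100] conjI allI impI)
  fix n f and p M :: real
  assume mono: "mono_on (cube {..<n}) f" and p: "0 \<le> p" "p \<le> critical_prob n f" and M: "M > 0"
    and global: "global_in n M {p..critical_prob n f} f"
    and large: "mu {..<n} p f \<ge> exp (- M / 100)"
  define I where "I = {..<n}"
  define c where "c = critical_prob n f"
  \<comment> \<open>Intersecting with \<open>I\<close> makes \<open>F\<close> monotone on all sets,
    while \<open>f\<close> is only assumed monotone on the cube.\<close>
  define F where "F = (\<lambda>A. f (\<lambda>i. i \<in> A \<inter> I))"
  have fin: "finite I" by (simp add: I_def)
  have mu_pos: "mu {..<n} p f > 0" using large by (auto intro: less_le_trans[OF exp_gt_zero])
  have F_mono: "F B" if "F A" "A \<subseteq> B" for A B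
  proof -
    have "(\<lambda>i. i \<in> A \<inter> I) \<in> cube I" "(\<lambda>i. i \<in> B \<inter> I) \<in> cube I"
      by (auto simp: cube_def PiE_dflt_def)
    from mono_onD[OF mono[folded I_def] this] that show ?thesis by (auto simp: F_def le_fun_def)
  qed
  have mu_F: "mu I q f = bexp I q (\<lambda>A. of_bool (F A))" if "0 \<le> q" "q \<le> 1" for q
    unfolding mu_eq_bexp[OF fin that] F_def by (intro bexp_cong) (simp add: Int_absorb2)
  have c1: "c \<le> 1" using critical_prob_bounds[OF mono mu_pos] by (simp add: c_def)
  show "critical_prob n f \<le> M powr 100 * p"
  proof (rule ccontr)
    assume "\<not> ?thesis"
    then have gap: "M powr 100 * p < c" by (simp add: c_def)
    then have c0: "0 < c" using p by (auto intro: le_less_trans[rotated])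
    have half: "mu I q f \<le> 1/2" if "0 \<le> q" "q \<le> c" for q
      using mu_le_half[of q n f] that c0 c1 by (simp add: c_def I_def)
    \<comment> \<open>As \<open>p \<le> c\<close>, the measure at \<open>p\<close> is at most 1/2,
      so the lower bound on it forces \<open>M \<ge> 100 * ln 2\<close>.\<close>
    have "exp (- M / 100) \<le> 1 / 2" using large half[of p] p by (simp add: I_def c_def)
    then have "2 \<le> exp (M / 100)" by (simp add: exp_minus field_simps)
    then have "ln 2 \<le> M / 100" using ln_le_cancel_iff[of 2 "exp (M / 100)"] by simp
    then have M66: "66 \<le> M" using ln2_ge_two_thirds by simp
    \<comment> \<open>At \<open>p = 0\<close> only the empty set has mass, so \<open>F {}\<close>
      holds and \<open>F\<close> is constantly true by monotonicity, contradicting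
      \<open>half\<close> at \<open>c\<close>.\<close>
    have p_pos: "p > 0"
    proof (rule ccontr)
      assume "\<not> ?thesis"
      then have "p = 0" using p by simp
      have pos: "bexp I 0 (\<lambda>A. of_bool (F A)) > 0"
        using mu_pos mu_F[of 0] \<open>p = 0\<close> by (simp add: I_def)
      have "F {}"
      proof (rule ccontr)
        assume "\<not> F {}"
        have "bexp I 0 (\<lambda>A. of_bool (F A)) = 0"
          unfolding bexp_def
        proof (rule sum.neutral, clarify)
          fix A assume "A \<subseteq> I"
          then show "0 ^ card A * (1 - 0) ^ card (I - A) * of_bool (F A) = (0::real)"
            using \<open>\<not> F {}\<close> fin finite_subset by (cases "A = {}") (auto simp: card_gt_0_iff)
        qed
        then show False using pos by simp
      qed
      then have "F A" for A by (rule F_mono) simp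
      then have "mu I c f = 1" using c0 c1 by (simp add: mu_F bexp_const[OF fin])
      then show False using half[of c] c0 by simp
    qed
    have p1: "p \<le> 1" using p c1 by (simp add: c_def)
    obtain J where J: "J \<subseteq> I"
      "2 ^ card J * bexp I p (\<lambda>A. of_bool (F A)) \<le> bexp I p (\<lambda>A. of_bool (F (A \<union> J)))"
      "\<And>S. S \<subseteq> I \<Longrightarrow> 0 \<le> p \<Longrightarrow> p \<le> 1 \<Longrightarrow> bexp I p (\<lambda>A. of_bool (F (A \<union> S \<union> J)))
        \<le> 2 ^ card S * bexp I p (\<lambda>A. of_bool (F (A \<union> J)))"
      using exists_spread_restriction[OF fin] by metis
    have large_F: "exp (- M / 100) \<le> bexp I p (\<lambda>A. of_bool (F A))"
      using large mu_F[of p] p p1 by (simp add: I_def)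
    \<comment> \<open>Restricting to \<open>J\<close> multiplies a measure of at least
      \<open>exp (- M / 100)\<close> by \<open>2 ^ card J\<close> or more, and the result cannot
      exceed one.\<close>
    have "real (card J) \<le> M"
    proof -
      have "2 ^ card J * exp (- M / 100) \<le> 2 ^ card J * bexp I p (\<lambda>A. of_bool (F A))"
        using large_F by (intro mult_left_mono) auto
      also have "\<dots> \<le> bexp I p (\<lambda>A. of_bool (F (A \<union> J)))" by (rule J(2))
      also have "\<dots> \<le> 1" using fin p p1 by (intro bexp_le_1) auto
      finally have "2 ^ card J \<le> exp (M / 100)" by (simp add: exp_minus field_simps)
      then have "ln (2 ^ card J) \<le> M / 100" 
        using ln_le_cancel_iff[of "2 ^ card J" "exp (M / 100)"] by simp
      then have "real (card J) * ln 2 \<le> M / 100" by (simp add: ln_realpow)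
      moreover have "real (card J) * (2 / 3) \<le> real (card J) * ln 2"
        using ln2_ge_two_thirds by (intro mult_left_mono) auto
      ultimately show ?thesis using M by linarith
    qed
    \<comment> \<open>Globality at \<open>c\<close> caps the restricted measure at
      \<open>(1/2) powr (1/100)\<close>, while spreadness will push it to at least 0.998.\<close>
    then have "mu (I - J) c (restrict_to_1 J f) \<le> mu I c f powr (1 / 100)"
      using global J(1) p by (simp add: global_in_def I_def c_def)
    also have "\<dots> \<le> (1 / 2) powr (1 / 100)"
      using half[of c] c0 c1 by (intro powr_mono2) (auto simp: mu_F intro!: bexp_nonneg)
    also have "\<dots> < 0.998" by (rule half_powr_less)
    finally have "bexp I c (\<lambda>A. of_bool (F (A \<union> J))) < 0.998"
      using c0 c1 by (simp add: mu_restrict_to_1[OF fin J(1)] F_def)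
    moreover have "0.998 \<le> bexp I c (\<lambda>A. of_bool (F (A \<union> J)))"
    proof (rule spread_imp_almost_sure[OF fin p_pos c1 _ M66])
      have "M ^ 4 = M powr 4" using M66 by simp
      also have "\<dots> \<le> M powr 100" using M66 by (intro powr_mono) auto
      finally have "M ^ 4 * p \<le> M powr 100 * p" using p by (intro mult_right_mono) auto
      then show "M ^ 4 * p \<le> c" using gap by simp
      show "F (B \<union> J)" if "F (A \<union> J)" "A \<subseteq> B" for A B
        using F_mono[OF that(1), of "B \<union> J"] that(2) by auto
      show "bexp I p (\<lambda>A. of_bool (F (A \<union> S \<union> J))) \<le> 2 ^ card S * bexp I p (\<lambda>A. of_bool (F (A \<union> J)))"
        if "S \<subseteq> I" for S using J(3)[OF that] p p1 by simp
      have "bexp I p (\<lambda>A. of_bool (F A)) \<le> bexp I p (\<lambda>A. of_bool (F (A \<union> J)))"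
        using p p1 F_mono by (intro bexp_mono) auto
      then show "exp (- M / 100) \<le> bexp I p (\<lambda>A. of_bool (F (A \<union> J)))" using large_F by simp
    qed
    ultimately show False by simp
  qed
qed simp

end
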